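(* Let $h$ be an odd positive integer, $m=3h$, $\ell=3^{2h}-3^h+1$, $\alpha$ a generator of $\mathrm{GF}(3^m)^*$, and $D=\{\alpha^t : 0\le t\le (3^m-1)/2-1,\ \mathrm{Tr}(\alpha^t+\alpha^{t\ell})=0\}$. Then the ternary code $\mathcal{C}_D$ has parameters $\left[\frac{3^{3h-1}-1}{2},\ 3h,\ 3^{3h-2}-3^{2h-2}\right]$ and its nonzero weights and multiplicities are: $3^{3h-2}-3^{2h-2}$ with multiplicity $3^{2h}+3^h$; $3^{3h-2}$ with multiplicity $3^{3h}-2\cdot3^{2h}-1$; $3^{3h-2}+3^{2h-2}$ with multiplicity $3^{2h}-3^h$.
   Context: $\mathrm{Tr}$ denotes the absolute trace from $\mathrm{GF}(3^m)$ onto $\mathrm{GF}(3)$. For a subset $D=\{d_1,\dots,d_n\}\subseteq\mathrm{GF}(3^m)$ (listed in a fixed order), $\mathcal{C}_D=\{(\mathrm{Tr}(xd_1),\dots,\mathrm{Tr}(xd_n)) : x\in\mathrm{GF}(3^m)\}$, a linear code of length $n$ over $\mathrm{GF}(3)$. *)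

theory Defs
  imports Main
begin

text \<open>Absolute trace from GF(3^m) onto GF(3), for a field 'a with 3^m elements:
  Tr(x) = x + x^3 + ... + x^(3^(m-1)). Its values lie in the prime field GF(3) inside 'a.\<close>
definition tr3 :: "nat \<Rightarrow> 'a::field \<Rightarrow> 'a" where
  "tr3 m x = (\<Sum>i<m. x ^ (3 ^ i))"

definition codeD :: "nat \<Rightarrow> 'a::field set \<Rightarrow> ('a \<Rightarrow> 'a) set" where
  "codeD m D = (\<lambda>x. \<lambda>d. if d \<in> D then tr3 m (x * d) else 0) ` UNIV"

definition hwt :: "'a set \<Rightarrow> ('a \<Rightarrow> 'b::zero) \<Rightarrow> nat" where
  "hwt D c = card {d \<in> D. c d \<noteq> 0}"

text \<open>Minimum distance of a linear code: minimum weight of a nonzero codeword.\<close>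
definition min_dist :: "'a set \<Rightarrow> ('a \<Rightarrow> 'b::zero) set \<Rightarrow> nat" where
  "min_dist D C = Min {hwt D c | c. c \<in> C \<and> c \<noteq> (\<lambda>_. 0)}"

end

theory Submission
  imports Defs Complex_Main "HOL-Computational_Algebra.Polynomial" "HOL-Computational_Algebra.Primes"
begin

text \<open>
  Write \<open>q = 3^h\<close> and \<open>S(b)\<close> for the sum of \<open>\<psi>(x^ell + b x)\<close> over \<open>x\<close>, where \<open>\<psi>\<close> is the canonical
  additive character. Expanding indicators into characters, the codeword of \<open>a \<noteq> 0\<close> has weight
  \<open>(q^3 - S(1 + a) - S(1 - a)) / 9\<close>, provided that \<open>S(1) = 0\<close>.

  Since \<open>(q + 1) ell = q^3 + 1\<close> and \<open>-1\<close> is a nonsquare, \<open>x = y^(q+1)\<close> and \<open>x = - y^(q+1)\<close> together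
  cover the field twice, so \<open>S(b)\<close> is the real part of the quadratic sum \<open>Q(b)\<close> of
  \<open>\<psi>(y^2 + b y^(q+1))\<close>. Its squared modulus is \<open>q^3\<close> times the size \<open>1\<close>, \<open>q\<close> or \<open>q^2\<close> of the radical
  of a ternary quadratic form over \<open>GF(q)\<close>. As \<open>Q(b) = X + C sqrt(-3)\<close> with integers \<open>X\<close>, \<open>C\<close>, the equation
  \<open>X^2 + 3 C^2 = 3^k\<close> forces \<open>S(b) \<in> {0, q^2, -q^2}\<close>, with \<open>S(b) \<noteq> 0\<close> only if the form is singular.

  Singularity at \<open>1 + a\<close> reads \<open>N(a) = (T(a) - 1)^2\<close> for the relative norm \<open>N\<close> and trace \<open>T\<close>. Hence
  \<open>S(1 + a)\<close> and \<open>S(1 - a)\<close> are never both nonzero: otherwise \<open>(T(a) - 1)^2 + (T(a) + 1)^2 = 0\<close>.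
  The first two moments of \<open>S\<close> then determine the multiplicities.
\<close>

section \<open>Finite fields of order \<open>3 ^ m\<close>: Frobenius, trace and additive
  character\<close>

text \<open>Multiplication by a nonzero \<open>x\<close> permutes the nonzero elements; comparing
  their products gives Lagrange's relation.\<close>

lemma finite_field_pow_card:
  fixes x :: "'a::{field,finite}"
  shows "x ^ card (UNIV :: 'a set) = x"
proof (cases "x = 0")
  case True
  then show ?thesis by (simp add: card_gt_0_iff)
next
  case False
  have "(\<Prod>y\<in>UNIV-{0}. x * y) = (\<Prod>y\<in>UNIV-{0}. y)"
    by (rule prod.reindex_bij_witness[of _ "\<lambda>y. y / x" "\<lambda>y. x * y"]) (use False in auto)
  then have "x ^ card (UNIV - {0::'a}) = 1"
    by (simp add: prod.distrib)
  moreover have "card (UNIV :: 'a set) = Suc (card (UNIV - {0::'a}))"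
    by (metis UNIV_I card_Suc_Diff1 finite_class.finite_UNIV)
  ultimately show ?thesis by (simp only: power_Suc mult_1_right)
qed

text \<open>A primitive cube root of unity; its conjugate is its square.\<close>

definition \<omega> :: complex where "\<omega> = Complex (-1/2) (sqrt 3 / 2)"

lemma omega_mult [simp]: "\<omega> * \<omega> = cnj \<omega>" "\<omega> * cnj \<omega> = 1" "cnj \<omega> * \<omega> = 1" "cnj \<omega> * cnj \<omega> = \<omega>"
  by (auto simp: \<omega>_def complex_eq_iff)

lemma Re_omega [simp]: "Re \<omega> = -1/2" and Im_omega [simp]: "Im \<omega> = sqrt 3 / 2"
  by (auto simp: \<omega>_def)

text \<open>The canonical additive character. The last branch stands for trace \<open>-1\<close>,
  the only other value by \<open>tr3_in_prime_field\<close>.\<close>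

definition psi3 :: "nat \<Rightarrow> 'a::field \<Rightarrow> complex" where
  "psi3 m x = (if tr3 m x = 0 then 1 else if tr3 m x = 1 then \<omega> else cnj \<omega>)"

locale ternary_field =
  fixes m :: nat and ty :: "'a::{field,finite} itself"
  assumes m_pos: "m > 0" and card_field: "card (UNIV :: 'a set) = 3 ^ m"
begin

text \<open>Translation by 1 permutes the field, so the sum of all elements forces the field order,
  a power of 3, to vanish in it.\<close>

lemma three_eq_0: "(3::'a) = 0"
proof -
  have "(\<Sum>x\<in>(UNIV::'a set). x + 1) = (\<Sum>x\<in>UNIV. x)"
    by (rule sum.reindex_bij_witness[of _ "\<lambda>y. y - 1" "\<lambda>y. y + 1"]) auto
  then have "of_nat (card (UNIV :: 'a set)) = (0::'a)"
    by (simp add: sum.distrib)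
  then show ?thesis by (simp add: card_field)
qed

lemma two_eq: "(2::'a) = -1"
  using three_eq_0 by (simp add: eq_neg_iff_add_eq_0)

lemma CHAR_eq_3: "CHAR('a) = 3"
proof (rule CHAR_eq_posI)
  fix x :: nat assume "x > 0" "x < 3"
  then have "x = 1 \<or> x = 2" by auto
  then show "of_nat x \<noteq> (0::'a)" by (auto simp: two_eq)
qed (use three_eq_0 in auto)

lemma frob_add: "(x + y :: 'a) ^ 3 ^ n = x ^ 3 ^ n + y ^ 3 ^ n"
  by (rule freshmans_dream'[of _ n]) (simp_all add: CHAR_eq_3)

lemma frob_minus: "(- x :: 'a) ^ 3 ^ n = - (x ^ 3 ^ n)"
  by (simp add: power_minus_odd)

lemma frob_diff: "(x - y :: 'a) ^ 3 ^ n = x ^ 3 ^ n - y ^ 3 ^ n"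
  using frob_add[of x "-y" n] by (simp add: frob_minus)

lemma power_card: "(x::'a) ^ 3 ^ m = x"
  using finite_field_pow_card[of x] by (simp add: card_field)

lemma tr3_add: "tr3 m (x + y :: 'a) = tr3 m x + tr3 m y"
  by (simp add: tr3_def frob_add sum.distrib)

lemma tr3_minus: "tr3 m (- x :: 'a) = - tr3 m x"
  by (simp add: tr3_def frob_minus sum_negf)

lemma tr3_0: "tr3 m (0::'a) = 0"
  by (simp add: tr3_def power_0_left)

text \<open>Cubing shifts the conjugates cyclically, because \<open>x ^ 3 ^ m = x\<close>.\<close>

lemma tr3_cube: "tr3 m ((x::'a) ^ 3) = tr3 m x"
proof -
  have "tr3 m (x ^ 3) = (\<Sum>i<m. x ^ 3 ^ Suc i)"
    by (simp add: tr3_def flip: power_mult)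
  also have "\<dots> = (\<Sum>i<Suc m. x ^ 3 ^ i) - x"
    by (subst sum.lessThan_Suc_shift) simp
  also have "\<dots> = tr3 m x"
    by (simp add: tr3_def power_card)
  finally show ?thesis .
qed

lemma tr3_frob: "tr3 m ((x::'a) ^ 3 ^ n) = tr3 m x"
proof (induction n)
  case (Suc n)
  have "x ^ 3 ^ Suc n = (x ^ 3 ^ n) ^ 3" by (metis power_Suc2 power_mult)
  then show ?case using Suc by (simp only: tr3_cube)
qed simp

text \<open>The trace is fixed by cubing, and \<open>t^3 - t\<close> factors as
  \<open>t (t - 1) (t + 1)\<close>.\<close>

lemma tr3_in_prime_field: "tr3 m (x::'a) = 0 \<or> tr3 m x = 1 \<or> tr3 m x = -1"
proof -
  have "(tr3 m x) ^ 3 = tr3 m (x ^ 3)"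
    unfolding tr3_def
    by (subst freshmans_dream_sum) (simp_all add: CHAR_eq_3 mult.commute flip: power_mult)
  then have "(tr3 m x) ^ 3 = tr3 m x" by (simp only: tr3_cube)
  then have "tr3 m x * (tr3 m x - 1) * (tr3 m x + 1) = 0"
    by (simp add: algebra_simps power3_eq_cube)
  then show ?thesis by (auto simp: eq_neg_iff_add_eq_0)
qed

text \<open>The trace is a nonzero polynomial of degree at most \<open>3 ^ (m - 1)\<close>, too
  small to vanish on the whole field.\<close>

lemma ex_tr3_nonzero: "\<exists>x::'a. tr3 m x \<noteq> 0"
proof (rule ccontr)
  assume "\<nexists>x::'a. tr3 m x \<noteq> 0"
  then have *: "tr3 m x = 0" for x :: 'a by blast
  define p :: "'a poly" where "p = (\<Sum>i<m. monom 1 (3 ^ i))"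
  have "poly p x = tr3 m x" for x
    by (simp add: p_def tr3_def poly_sum poly_monom)
  then have "{x. poly p x = 0} = UNIV" by (simp add: *)
  moreover have "coeff p 1 = 1"
  proof -
    have "coeff p 1 = (\<Sum>i<m. if i = 0 then 1 else 0)"
      unfolding p_def coeff_sum by (rule sum.cong) auto
    then show ?thesis using m_pos by simp
  qed
  then have "p \<noteq> 0" by auto
  moreover have "degree p \<le> 3 ^ (m - 1)"
    unfolding p_def
    by (rule degree_sum_le) (auto intro: degree_monom_le[THEN order_trans] power_increasing)
  ultimately have "(3::nat) ^ m \<le> 3 ^ (m - 1)"
    using card_poly_roots_bound[of p] card_field by (metis order_trans)
  then show False using m_pos by simp
qed

lemma psi3_0 [simp]: "psi3 m (0::'a) = 1"
  by (simp add: psi3_def tr3_0)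

lemma neg_one_neq: "(-1::'a) \<noteq> 1" "(1::'a) \<noteq> -1"
  using two_eq by (metis add.right_inverse one_add_one one_neq_zero)+

lemma psi3_add: "psi3 m (x + y :: 'a) = psi3 m x * psi3 m y"
proof -
  have "(1::'a) + 1 = -1" "(-1::'a) + -1 = 1" "(-1::'a) - 1 = 1" using two_eq by simp_all
  note arith = this neg_one_neq two_eq
  consider "tr3 m x = 0" | "tr3 m x = 1" | "tr3 m x = -1" using tr3_in_prime_field by blast
  then show ?thesis
  proof cases
    case 1
    then show ?thesis by (simp add: psi3_def tr3_add)
  next
    case 2
    consider "tr3 m y = 0" | "tr3 m y = 1" | "tr3 m y = -1" using tr3_in_prime_field by blast
    then show ?thesis using 2 by cases (simp_all add: psi3_def tr3_add arith)
  next
    case 3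
    consider "tr3 m y = 0" | "tr3 m y = 1" | "tr3 m y = -1" using tr3_in_prime_field by blast
    then show ?thesis using 3 by cases (simp_all add: psi3_def tr3_add arith)
  qed
qed

lemma psi3_minus: "psi3 m (- x :: 'a) = cnj (psi3 m x)"
proof -
  consider "tr3 m x = 0" | "tr3 m x = 1" | "tr3 m x = -1" using tr3_in_prime_field by blast
  then show ?thesis by cases (simp_all add: psi3_def tr3_minus neg_one_neq)
qed

lemma psi3_diff: "psi3 m (x - y :: 'a) = psi3 m x * cnj (psi3 m y)"
  using psi3_add[of x "-y"] by (simp add: psi3_minus)

lemma psi3_frob: "psi3 m ((x::'a) ^ 3 ^ n) = psi3 m x"
  by (simp add: psi3_def tr3_frob)

text \<open>Orthogonality: for nonzero \<open>c\<close>, translating by \<open>u / c\<close>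
  multiplies the sum by \<open>psi3 m u\<close>, which differs from 1 when \<open>u\<close> has
  nonzero trace.\<close>

lemma sum_psi3: "(\<Sum>x\<in>UNIV. psi3 m ((c::'a) * x)) = (if c = 0 then of_nat (3 ^ m) else 0)"
proof (cases "c = 0")
  case True
  then have "(\<Sum>x\<in>UNIV. psi3 m (c * x)) = of_nat (card (UNIV :: 'a set))"
    by simp
  then show ?thesis using True unfolding card_field by simp
next
  case False
  obtain u :: 'a where u: "tr3 m u \<noteq> 0" using ex_tr3_nonzero by blast
  have "Re (psi3 m u) \<noteq> Re 1"
    using u by (simp add: psi3_def)
  then have "psi3 m u \<noteq> 1" by metis
  have "(\<Sum>x\<in>UNIV. psi3 m (c * x)) = (\<Sum>x\<in>UNIV. psi3 m (c * (x + u / c)))"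
    by (rule sum.reindex_bij_witness[of _ "\<lambda>y. y + u / c" "\<lambda>y. y - u / c"]) auto
  also have "\<dots> = (\<Sum>x\<in>UNIV. psi3 m (c * x)) * psi3 m u"
    using False by (simp add: distrib_left psi3_add sum_distrib_right)
  finally show ?thesis using \<open>psi3 m u \<noteq> 1\<close> False by simp
qed

lemma tr3_eq_0_indicator:
  "(if tr3 m (x::'a) = 0 then 1 else 0) = (1 + psi3 m x + cnj (psi3 m x)) / 3"
  by (auto simp: psi3_def complex_eq_iff)

end

section \<open>A parity principle and a Diophantine equation\<close>

lemma even_card_fixpoint_free_involution:
  assumes "finite A" "\<And>x. x \<in> A \<Longrightarrow> f x \<in> A" "\<And>x. x \<in> A \<Longrightarrow> f (f x) = x"
    "\<And>x. x \<in> A \<Longrightarrow> f x \<noteq> x"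
  shows "even (card A)"
  using assms
proof (induction "card A" arbitrary: A rule: less_induct)
  case less
  show ?case
  proof (cases "A = {}")
    case False
    then obtain x where x: "x \<in> A" by blast
    let ?B = "A - {x, f x}"
    have two: "card {x, f x} = 2" "{x, f x} \<subseteq> A" using less.prems(2) less.prems(4)[OF x] x by auto
    then have card: "card A = card ?B + 2"
      using less.prems(1) by (metis card_Diff_subset card_mono finite.emptyI finite.insertI le_add_diff_inverse2)
    have "even (card ?B)"
    proof (rule less.hyps)
      show "f y \<in> ?B" if "y \<in> ?B" for y
        using that less.prems(2,3)[of y] less.prems(3)[OF x] by auto
    qed (use card less.prems in auto)
    then show ?thesis using card by simp
  qed simp
qed

text \<open>Descent: 3 divides \<^term>\<open>x\<close>, and dividing the equation by 3 swaps the roles of the two squares.\<close>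
lemma sq_plus_three_sq_eq_power_three:
  fixes x y :: int
  assumes "x\<^sup>2 + 3 * y\<^sup>2 = 3 ^ k"
  shows "if even k then y = 0 else x = 0"
  using assms
proof (induction k arbitrary: x y)
  case 0
  have "y\<^sup>2 = 0"
    using 0 zero_le_power2[of x] zero_le_power2[of y] unfolding power_0 by linarith
  then show ?case by simp
next
  case (Suc k)
  have "3 dvd x\<^sup>2"
    using Suc.prems by (metis dvd_add_left_iff dvd_triv_left power_Suc)
  moreover have "prime (3::int)" by simp
  ultimately have "3 dvd x" using prime_dvd_power by blast
  then obtain z where x: "x = 3 * z" by blast
  then have "y\<^sup>2 + 3 * z\<^sup>2 = 3 ^ k" using Suc.prems by (simp add: power2_eq_square)
  from Suc.IH[OF this] show ?case by (auto simp: x)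
qed

section \<open>The cubic extension of GF(q): Frobenius, squares and the subfield\<close>

locale cubic_field = ternary_field "3 * h" ty for h :: nat and ty :: "'a::{field,finite} itself" +
  assumes odd_h: "odd h"
begin

abbreviation \<psi> :: "'a \<Rightarrow> complex" where "\<psi> \<equiv> psi3 (3 * h)"

text \<open>The \<open>q\<close>-Frobenius, which generates the Galois group over GF(q); applied
  twice, it is its own inverse map.\<close>

definition \<sigma> :: "'a \<Rightarrow> 'a" where "\<sigma> x = x ^ 3 ^ h"

lemma h_pos: "h > 0"
  using odd_h by (cases h) auto

lemma sigma_sigma: "\<sigma> (\<sigma> x) = x ^ 3 ^ (2 * h)"
  by (simp add: \<sigma>_def mult_2 power_add flip: power_mult)

lemma sigma_cube [simp]: "\<sigma> (\<sigma> (\<sigma> x)) = x"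
proof -
  have "\<sigma> (\<sigma> (\<sigma> x)) = x ^ 3 ^ (2 * h + h)"
    unfolding sigma_sigma[of x] by (simp only: \<sigma>_def power_add power_mult)
  also have "2 * h + h = 3 * h" by simp
  finally show ?thesis unfolding power_card .
qed

lemma sigma_hom [simp]: "\<sigma> (x + y) = \<sigma> x + \<sigma> y" "\<sigma> (x - y) = \<sigma> x - \<sigma> y" "\<sigma> (x * y) = \<sigma> x * \<sigma> y"
  "\<sigma> (x / y) = \<sigma> x / \<sigma> y" "\<sigma> 0 = 0" "\<sigma> 1 = 1" "\<sigma> (- x) = - \<sigma> x"
  by (simp_all add: \<sigma>_def frob_add frob_diff frob_minus power_mult_distrib power_divide power_0_left)

lemma sigma_2 [simp]: "\<sigma> 2 = 2"
  using sigma_hom(1)[of 1 1] by simp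

lemma psi_sigma [simp]: "\<psi> (\<sigma> x) = \<psi> x"
  by (simp add: \<sigma>_def psi3_frob)

text \<open>As \<open>3 * h\<close> is odd, the field order is 3 modulo 4. A root \<open>x\<close>
  of \<open>-1\<close> has \<open>x^4 = 1\<close>, so \<open>x = x^(4k+3) = x^3 = -x\<close>, which
  is impossible.\<close>

lemma minus_one_not_square: "x * x \<noteq> (-1::'a)"
proof
  assume *: "x * x = -1"
  have "odd (3 * h)" using odd_h by simp
  then obtain j where "3 * h = 2 * j + 1" by (rule oddE)
  then have "(3::nat) ^ (3 * h) mod 4 = (3 * 9 ^ j) mod 4"
    by (simp add: power_add power_mult)
  also have "\<dots> = 3"
  proof (induction j)
    case (Suc j)
    have "3 * (9::nat) ^ Suc j = 3 * 9 ^ j + 4 * (9 ^ j * 6)" by simp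
    then show ?case using Suc by (metis mod_mult_self2)
  qed simp
  finally obtain k where k: "(3::nat) ^ (3 * h) = 4 * k + 3"
    by (metis mult_div_mod_eq)
  have "x = x ^ (4 * k + 3)" using power_card[of x] by (simp only: k)
  also have "\<dots> = ((x * x) * (x * x)) ^ k * (x * x * x)"
    by (simp add: power_add power_mult power4_eq_xxxx power3_eq_cube mult.assoc)
  finally have "x = - x" by (simp add: *)
  then have "2 * x = 0" by (metis add.right_inverse mult_2)
  then have "x = 0" by (simp add: two_eq)
  then show False using * by simp
qed

lemma sum_squares_eq_0:
  fixes u v :: 'a
  assumes "u * u + v * v = 0"
  shows "u = 0 \<and> v = 0"
proof (cases "v = 0")
  case False
  then have "(u / v) * (u / v) = -1"
    using assms by (simp add: field_simps eq_neg_iff_add_eq_0)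
  then show ?thesis using minus_one_not_square by blast
qed (use assms in simp)

text \<open>A root count for a polynomial of degree at most \<open>q^2\<close>; the linear
  coefficient \<open>c1\<close> witnesses that it is nonzero.\<close>

lemma card_linearized_roots:
  fixes c0 c1 c2 c3 :: 'a
  assumes "c1 \<noteq> 0"
  shows "card {x. c0 + c1 * x + c2 * \<sigma> x + c3 * \<sigma> (\<sigma> x) = 0} \<le> 3 ^ (2 * h)"
proof -
  define p where "p = monom c0 0 + monom c1 1 + monom c2 (3 ^ h) + monom c3 (3 ^ (2 * h))"
  have "poly p x = c0 + c1 * x + c2 * \<sigma> x + c3 * \<sigma> (\<sigma> x)" for x
    unfolding p_def sigma_sigma by (simp add: poly_monom \<sigma>_def)
  moreover have "coeff p 1 = c1"
    using h_pos by (simp add: p_def)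
  then have "p \<noteq> 0" using assms by auto
  moreover have "degree p \<le> 3 ^ (2 * h)"
    unfolding p_def
    by (intro degree_add_le degree_monom_le[THEN order_trans]) (simp_all add: power_increasing)
  ultimately show ?thesis using card_poly_roots_bound[of p] by simp
qed

definition K :: "'a set" where "K = {x. \<sigma> x = x}"

text \<open>Above, \<open>K\<close> consists of the roots of \<open>X^q - X\<close>. Below, the
  relative trace maps all \<open>q^3\<close> elements into \<open>K\<close> with fibres of size at
  most \<open>q^2\<close>.\<close>

lemma card_K: "card K = 3 ^ h"
proof (rule antisym)
  define p :: "'a poly" where "p = monom 1 (3 ^ h) - monom 1 1"
  have "poly p x = \<sigma> x - x" for x by (simp add: p_def poly_monom \<sigma>_def)
  then have "K = {x. poly p x = 0}" by (auto simp: K_def)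
  moreover have "coeff p 1 = -1" using h_pos by (simp add: p_def)
  then have "p \<noteq> 0" by auto
  moreover have "degree p \<le> 3 ^ h"
    unfolding p_def by (intro degree_diff_le degree_monom_le[THEN order_trans]) simp_all
  ultimately show "card K \<le> 3 ^ h" using card_poly_roots_bound[of p] by simp
next
  define T where "T x = x + \<sigma> x + \<sigma> (\<sigma> x)" for x
  have "T x \<in> K" for x by (simp add: T_def K_def algebra_simps)
  then have "(\<Sum>k\<in>K. card {x \<in> UNIV. T x = k}) = card (UNIV :: 'a set)"
    using sum.group[of UNIV K T "\<lambda>_. 1::nat"] by (simp add: image_subset_iff)
  moreover have "card {x \<in> UNIV. T x = k} \<le> 3 ^ (2 * h)" for k
  proof -
    have "{x \<in> UNIV. T x = k} = {x. - k + 1 * x + 1 * \<sigma> x + 1 * \<sigma> (\<sigma> x) = 0}"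
      by (auto simp: T_def algebra_simps)
    then show ?thesis using card_linearized_roots[of 1 "-k" 1 1] by simp
  qed
  then have "(\<Sum>k\<in>K. card {x \<in> UNIV. T x = k}) \<le> card K * 3 ^ (2 * h)"
    using sum_bounded_above by (metis (no_types, lifting) of_nat_id)
  ultimately have "3 ^ h * 3 ^ (2 * h) \<le> card K * 3 ^ (2 * h)"
    by (simp add: card_field flip: power_add)
  then show "3 ^ h \<le> card K" by simp
qed

section \<open>The quadratic sum and its radical\<close>

definition Q :: "'a \<Rightarrow> complex" where "Q b = (\<Sum>y\<in>UNIV. \<psi> (y * y + b * (y * \<sigma> y)))"

text \<open>The left side represents the polar form of \<open>y * y + b * (y * \<sigma> y)\<close>
  under the trace pairing. Its last term comes from moving \<sigma> off \<open>z\<close> in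
  \<open>b * y * \<sigma> z\<close>, the inverse of \<sigma> being \<sigma> applied twice.\<close>

definition Rad :: "'a \<Rightarrow> 'a set" where "Rad b = {y. 2 * y + b * \<sigma> y + \<sigma> (\<sigma> (b * y)) = 0}"

text \<open>Differencing makes the exponent linear in \<open>z\<close>, so orthogonality keeps only
  \<open>y\<close> in the radical, where the remaining factor is 1.\<close>

lemma norm_Q: "Q b * cnj (Q b) = of_nat (3 ^ (3 * h) * card (Rad b))"
proof -
  define \<phi> where "\<phi> y = y * y + b * (y * \<sigma> y)" for y
  define L where "L y = 2 * y + b * \<sigma> y + \<sigma> (\<sigma> (b * y))" for y
  have polar: "\<psi> (\<phi> (y + z) - \<phi> z) = \<psi> (\<phi> y) * \<psi> (L y * z)" for y z
  proof -
    have "\<phi> (y + z) - \<phi> z = \<phi> y + ((2 * y + b * \<sigma> y) * z + b * y * \<sigma> z)"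
      by (simp add: \<phi>_def algebra_simps)
    moreover have "\<psi> (b * y * \<sigma> z) = \<psi> (\<sigma> (\<sigma> (b * y)) * z)"
      using psi_sigma[of "b * y * \<sigma> z"] psi_sigma[of "\<sigma> (b * y * \<sigma> z)"] by simp
    moreover have "L y * z = (2 * y + b * \<sigma> y) * z + \<sigma> (\<sigma> (b * y)) * z"
      unfolding L_def by (simp only: distrib_right)
    ultimately show ?thesis by (simp only: psi3_add)
  qed
  \<comment> \<open>Polarity at \<open>z = y\<close> leaves \<open>\<psi> (\<phi> y)\<close>,
    whereas \<open>\<phi> (2 y) - \<phi> y = 3 \<phi> y = 0\<close>.\<close>
  have rad: "\<psi> (\<phi> y) = 1" if "L y = 0" for y
  proof -
    have "\<psi> (\<phi> (y + y) - \<phi> y) = \<psi> (\<phi> y)" using polar[of y y] that by simp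
    moreover have "\<phi> (y + y) = 4 * \<phi> y" by (simp add: \<phi>_def algebra_simps)
    moreover have "4 * \<phi> y - \<phi> y = 3 * \<phi> y" by simp
    ultimately show ?thesis by (simp add: three_eq_0)
  qed
  have "Q b * cnj (Q b) = (\<Sum>z\<in>UNIV. \<Sum>u\<in>UNIV. \<psi> (\<phi> u - \<phi> z))"
    unfolding Q_def \<phi>_def by (subst sum.swap) (simp add: sum_product psi3_diff)
  also have "\<dots> = (\<Sum>z\<in>UNIV. \<Sum>y\<in>UNIV. \<psi> (\<phi> (y + z) - \<phi> z))"
  proof (rule sum.cong[OF refl])
    fix z
    show "(\<Sum>u\<in>UNIV. \<psi> (\<phi> u - \<phi> z)) = (\<Sum>y\<in>UNIV. \<psi> (\<phi> (y + z) - \<phi> z))"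
      by (rule sum.reindex_bij_witness[of _ "\<lambda>y. y + z" "\<lambda>y. y - z"]) auto
  qed
  also have "\<dots> = (\<Sum>y\<in>UNIV. \<psi> (\<phi> y) * (\<Sum>z\<in>UNIV. \<psi> (L y * z)))"
    by (subst sum.swap) (simp add: polar sum_distrib_left)
  also have "\<dots> = (\<Sum>y\<in>UNIV. if L y = 0 then of_nat (3 ^ (3 * h)) else 0)"
    by (rule sum.cong) (simp_all add: sum_psi3 rad)
  also have "\<dots> = of_nat (3 ^ (3 * h) * card (Rad b))"
    by (simp add: sum.If_cases Rad_def L_def)
  finally show ?thesis .
qed

text \<open>The radical is a vector space over \<open>K\<close>, since \<sigma> fixes
  \<open>K\<close>. The root bound \<open>q^2\<close> limits its dimension to 2, and two independent
  vectors already span \<open>q^2\<close> elements.\<close>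

lemma card_Rad: "card (Rad b) \<in> {1, 3 ^ h, 3 ^ (2 * h)}"
proof -
  have le: "card (Rad b) \<le> 3 ^ (2 * h)"
    using card_linearized_roots[of 2 0 b "\<sigma> (\<sigma> b)"] by (simp add: Rad_def two_eq)
  have zero: "0 \<in> Rad b" by (simp add: Rad_def)
  have comb: "s * y + t * z \<in> Rad b" if "s \<in> K" "t \<in> K" "y \<in> Rad b" "z \<in> Rad b" for s t y z
  proof -
    have "2 * (s * y + t * z) + b * \<sigma> (s * y + t * z) + \<sigma> (\<sigma> (b * (s * y + t * z)))
      = s * (2 * y + b * \<sigma> y + \<sigma> (\<sigma> (b * y))) + t * (2 * z + b * \<sigma> z + \<sigma> (\<sigma> (b * z)))"
      using that(1,2) by (simp add: K_def algebra_simps)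
    then show ?thesis using that(3,4) by (simp add: Rad_def)
  qed
  show ?thesis
  proof (cases "Rad b = {0}")
    case False
    then obtain y where y: "y \<in> Rad b" "y \<noteq> 0" using zero by blast
    let ?Y = "(\<lambda>s. s * y) ` K"
    have cY: "card ?Y = 3 ^ h"
      using y by (subst card_image) (auto simp: inj_on_def card_K)
    have sub: "?Y \<subseteq> Rad b" using comb[OF _ _ y(1) zero, of _ 0] by (auto simp: K_def)
    show ?thesis
    proof (cases "Rad b = ?Y")
      case False
      then obtain z where z: "z \<in> Rad b" "z \<notin> ?Y" using sub by blast
      let ?f = "\<lambda>(s, t). s * y + t * z"
      have "inj_on ?f (K \<times> K)"
      proof (rule inj_onI, clarify)
        fix s t s' t' assume K: "s \<in> K" "t \<in> K" "s' \<in> K" "t' \<in> K"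
          and eq: "s * y + t * z = s' * y + t' * z"
        have "t = t'"
        proof (rule ccontr)
          assume "t \<noteq> t'"
          then have "z = ((s' - s) / (t - t')) * y"
            using eq by (simp add: field_simps)
          moreover have "(s' - s) / (t - t') \<in> K" using K by (simp add: K_def)
          ultimately show False using z(2) by blast
        qed
        then show "s = s' \<and> t = t'" using eq y by simp
      qed
      then have "card (?f ` (K \<times> K)) = 3 ^ h * 3 ^ h"
        by (simp add: card_image card_cartesian_product card_K)
      moreover have "?f ` (K \<times> K) \<subseteq> Rad b" using comb y z by auto
      ultimately have "3 ^ h * 3 ^ h \<le> card (Rad b)"
        by (metis card_mono finite)
      then show ?thesis using le by (simp add: mult_2 power_add)
    qed (use cY in simp)
  qed simp
qed

text \<open>The radical equation and its two conjugates form a homogeneous 3 by 3 system in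
  \<open>y\<close>, \<open>\<sigma> y\<close>, \<open>\<sigma> (\<sigma> y)\<close>; a nonzero
  solution makes the determinant vanish.\<close>

lemma Rad_nontrivial:
  assumes "y \<in> Rad b" "y \<noteq> 0"
  shows "1 + b * \<sigma> b * \<sigma> (\<sigma> b) = b * b + \<sigma> b * \<sigma> b + \<sigma> (\<sigma> b) * \<sigma> (\<sigma> b)"
proof -
  define b1 b2 y1 y2 where "b1 = \<sigma> b" and "b2 = \<sigma> (\<sigma> b)" and "y1 = \<sigma> y" and "y2 = \<sigma> (\<sigma> y)"
  note d = b1_def b2_def y1_def y2_def
  have 1: "2 * y + b * y1 + b2 * y2 = 0" using assms by (simp add: Rad_def d)
  have "\<sigma> (2 * y + b * y1 + b2 * y2) = 0" using 1 by simp
  then have 2: "2 * y1 + b1 * y2 + b * y = 0" by (simp add: d)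
  have "\<sigma> (2 * y1 + b1 * y2 + b * y) = 0" using 2 by simp
  then have 3: "2 * y2 + b2 * y + b1 * y1 = 0" by (simp add: d)
  \<comment> \<open>The multipliers of the three equations are the cofactors of the first column.
    Modulo 3 the determinant is the negative of the wanted expression.\<close>
  have "(1 + b * b1 * b2 - (b * b + b1 * b1 + b2 * b2)) * y
    = 3 * ((3 + b * b1 * b2 - (b * b + b1 * b1 + b2 * b2)) * y)
      - ((4 - b1 * b1) * (2 * y + b * y1 + b2 * y2) + (b1 * b2 - 2 * b) * (2 * y1 + b1 * y2 + b * y)
        + (b * b1 - 2 * b2) * (2 * y2 + b2 * y + b1 * y1))"
    by (simp add: algebra_simps)
  then have "(1 + b * b1 * b2 - (b * b + b1 * b1 + b2 * b2)) * y = 0"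
    by (simp add: 1 2 3 three_eq_0)
  then show ?thesis using assms(2) by (simp add: d)
qed

section \<open>The exponent and the signed double cover by \<open>y * \<sigma> y\<close>\<close>

definition ell :: nat where "ell = 3 ^ (2 * h) - 3 ^ h + 1"

lemma ell_add: "ell + 3 ^ h = 3 ^ h * 3 ^ h + 1"
proof -
  have "(3::nat) ^ h \<le> 3 ^ (2 * h)" by (rule power_increasing) auto
  then show ?thesis by (simp add: ell_def mult_2 power_add)
qed

lemma odd_ell: "odd ell"
proof -
  have "even (ell + 3 ^ h)" unfolding ell_add by simp
  then show ?thesis by simp
qed

lemma pow_ell: "(y * \<sigma> y) ^ ell = y * y"
proof -
  \<comment> \<open>Adding \<open>3 ^ h\<close> to \<open>ell\<close> keeps the computation of
    \<open>(q + 1) ell\<close> free of natural subtraction.\<close>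
  have "(3 ^ h + 1) * (ell + 3 ^ h) = (3 ^ h + 1) * (3 ^ h * 3 ^ h + 1)"
    by (simp only: ell_add)
  then have "(3 ^ h + 1) * ell = 3 ^ h * 3 ^ h * 3 ^ h + 1" by (simp add: algebra_simps)
  also have "\<dots> = 3 ^ (3 * h) + 1"
    by (simp add: mult.commute[of 3] power_mult power3_eq_cube)
  finally have "y ^ ((3 ^ h + 1) * ell) = y ^ 3 ^ (3 * h) * y" by simp
  then have "y ^ ((3 ^ h + 1) * ell) = y * y" by (simp only: power_card)
  moreover have "(y * \<sigma> y) ^ ell = y ^ ((3 ^ h + 1) * ell)"
    unfolding \<sigma>_def power_mult by simp
  ultimately show ?thesis by simp
qed

text \<open>The \<^term>\<open>ell\<close>-th power of \<^term>\<open>y * \<sigma> y\<close> is \<^term>\<open>y * y\<close>, so each sign class has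
  at most two preimages and, \<open>-1\<close> being a nonsquare, only one sign occurs; a count gives equality.\<close>
lemma card_signed_fibre: "card {y. y * \<sigma> y = x} + card {y. y * \<sigma> y = - x} = 2"
proof -
  let ?n = "\<lambda>x. card {y. y * \<sigma> y = x}"
  have le: "?n x + ?n (- x) \<le> 2" for x
  proof (cases "x = 0")
    case True
    have "{y. y * \<sigma> y = 0} = {0}" by (auto simp: \<sigma>_def)
    then show ?thesis by (simp add: True)
  next
    case False
    have bound: "?n x + ?n (- x) \<le> 2" if "y * \<sigma> y = x" "x \<noteq> 0" for x y
    proof -
      have "z = y \<or> z = - y" if "z * \<sigma> z = x" for z
        using pow_ell[of y] pow_ell[of z] that \<open>y * \<sigma> y = x\<close>
        by (metis square_eq_iff)
      then have "{z. z * \<sigma> z = x} \<subseteq> {y, - y}" by blast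
      then have "?n x \<le> card {y, - y}" by (intro card_mono) auto
      also have "\<dots> \<le> 2" by (simp add: card_insert_if)
      finally have "?n x \<le> 2" .
      moreover have "z * \<sigma> z \<noteq> - x" for z
      proof
        assume "z * \<sigma> z = - x"
        then have "z * z = (- x) ^ ell" using pow_ell[of z] by simp
        also have "\<dots> = - (x ^ ell)" using odd_ell by (simp add: power_minus_odd)
        also have "x ^ ell = y * y" using pow_ell[of y] that(1) by simp
        finally have "y * y + z * z = 0" by simp
        then have "y = 0" using sum_squares_eq_0 by blast
        then show False using that by simp
      qed
      then have "{z. z * \<sigma> z = - x} = {}" by blast
      ultimately show ?thesis by (metis add.right_neutral card.empty)
    qed
    show ?thesis
    proof (cases "{y. y * \<sigma> y = x} = {}")
      case True
      show ?thesis
      proof (cases "{y. y * \<sigma> y = - x} = {}")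
        case False
        then obtain y where "y * \<sigma> y = - x" by blast
        from bound[OF this] \<open>x \<noteq> 0\<close> show ?thesis by simp
      qed (use True in simp)
    next
      case nonempty: False
      then show ?thesis using bound[of _ x] False by blast
    qed
  qed
  have tot: "(\<Sum>x\<in>UNIV. ?n x) = card (UNIV :: 'a set)"
    using sum.group[of UNIV UNIV "\<lambda>y. y * \<sigma> y" "\<lambda>_. 1::nat"] by simp
  moreover have "(\<Sum>x\<in>UNIV. ?n (- x)) = (\<Sum>x\<in>UNIV. ?n x)"
    by (rule sum.reindex_bij_witness[of _ uminus uminus]) auto
  ultimately have "(\<Sum>x\<in>UNIV. ?n x + ?n (- x)) = (\<Sum>x\<in>(UNIV::'a set). 2)"
    by (simp add: sum.distrib)
  from sum_mono_inv[OF this le] show ?thesis by simp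
qed

text \<open>The substitution behind the evaluation of \<open>S\<close>: every \<open>x\<close> is
  hit exactly twice by the two signs together.\<close>

lemma sum_signed_fibres:
  fixes g :: "'a \<Rightarrow> complex"
  shows "(\<Sum>y\<in>UNIV. g (y * \<sigma> y) + g (- (y * \<sigma> y))) = 2 * (\<Sum>x\<in>UNIV. g x)"
proof -
  have group: "(\<Sum>y\<in>UNIV. f (y * \<sigma> y)) = (\<Sum>x\<in>UNIV. of_nat (card {y. y * \<sigma> y = x}) * f x)"
    for f :: "'a \<Rightarrow> complex"
  proof -
    have "(\<Sum>y\<in>UNIV. f (y * \<sigma> y)) = (\<Sum>x\<in>UNIV. \<Sum>y\<in>{y\<in>UNIV. y * \<sigma> y = x}. f (y * \<sigma> y))"
      by (rule sum.group[symmetric]) auto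
    then show ?thesis by simp
  qed
  have "(\<Sum>y\<in>UNIV. g (- (y * \<sigma> y))) = (\<Sum>x\<in>UNIV. of_nat (card {y. y * \<sigma> y = x}) * g (- x))"
    by (rule group)
  also have "\<dots> = (\<Sum>x\<in>UNIV. of_nat (card {y. y * \<sigma> y = - x}) * g x)"
    by (rule sum.reindex_bij_witness[of _ uminus uminus]) auto
  finally have "(\<Sum>y\<in>UNIV. g (y * \<sigma> y) + g (- (y * \<sigma> y)))
    = (\<Sum>x\<in>UNIV. of_nat (card {y. y * \<sigma> y = x} + card {y. y * \<sigma> y = - x}) * g x)"
    by (simp add: sum.distrib group distrib_right)
  then show ?thesis by (simp only: card_signed_fibre of_nat_numeral sum_distrib_left)
qed

section \<open>Values of the exponential sum\<close>

definition S :: "'a \<Rightarrow> complex" where "S b = (\<Sum>x\<in>UNIV. \<psi> (x ^ ell + b * x))"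

text \<open>As \<open>ell\<close> is odd, changing the sign of \<open>y * \<sigma> y\<close> negates
  the whole argument, so the two branches contribute conjugate terms.\<close>

lemma S_eq_Re_Q: "S b = of_real (Re (Q b))"
proof -
  have "\<psi> ((- (y * \<sigma> y)) ^ ell + b * - (y * \<sigma> y)) = cnj (\<psi> (y * y + b * (y * \<sigma> y)))" for y
  proof -
    have "(- (y * \<sigma> y)) ^ ell + b * - (y * \<sigma> y) = - (y * y + b * (y * \<sigma> y))"
      using odd_ell pow_ell[of y] by (simp add: power_minus_odd)
    then show ?thesis by (simp only: psi3_minus)
  qed
  then have "2 * S b = Q b + cnj (Q b)"
    unfolding S_def by (subst sum_signed_fibres[symmetric]) (simp add: Q_def pow_ell sum.distrib)
  then show ?thesis by (simp add: complex_add_cnj)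
qed

lemma cnj_S [simp]: "cnj (S b) = S b"
  by (simp add: S_eq_Re_Q)

text \<open>The summand is even in \<^term>\<open>y\<close>, so the values \<^term>\<open>\<omega>\<close> and \<^term>\<open>cnj \<omega>\<close> are each taken an even number of times.\<close>
lemma Q_integral: "\<exists>X C :: int. Q b = Complex (of_int X) (of_int C * sqrt 3)"
proof -
  define \<phi> where "\<phi> y = y * y + b * (y * \<sigma> y)" for y
  define A where "A v = {y. tr3 (3 * h) (\<phi> y) = v}" for v
  have ev: "even (card (A v))" if "v \<noteq> 0" for v
  proof (rule even_card_fixpoint_free_involution[where f = uminus])
    show "- y \<noteq> y" if "y \<in> A v" for y
    proof
      assume "- y = y"
      then have "2 * y = 0" by (metis add.right_inverse mult_2)
      then have "y = 0" by (simp add: two_eq)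
      then show False using that \<open>v \<noteq> 0\<close> by (simp add: A_def \<phi>_def tr3_0)
    qed
  qed (auto simp: A_def \<phi>_def)
  obtain i j where ij: "card (A 1) = 2 * i" "card (A (-1)) = 2 * j"
    using ev[of 1] ev[of "-1"] by (auto elim!: evenE)
  have "Q b = (\<Sum>v\<in>{0,1,-1}. \<Sum>y\<in>{y\<in>UNIV. tr3 (3 * h) (\<phi> y) = v}. \<psi> (\<phi> y))"
    unfolding Q_def \<phi>_def using tr3_in_prime_field by (intro sum.group[symmetric]) auto
  also have "\<dots> = (\<Sum>v\<in>{0,1,-1}. \<Sum>y\<in>A v. (if v = 0 then 1 else if v = 1 then \<omega> else cnj \<omega>))"
    by (intro sum.cong) (auto simp: A_def psi3_def)
  also have "\<dots> = of_nat (card (A 0)) + of_nat (card (A 1)) * \<omega> + of_nat (card (A (-1))) * cnj \<omega>"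
    using neg_one_neq by simp
  also have "\<dots> = Complex (of_int (int (card (A 0)) - int i - int j)) (of_int (int i - int j) * sqrt 3)"
    by (simp add: ij complex_eq_iff algebra_simps)
  finally show ?thesis by blast
qed

text \<open>The three radical sizes give \<open>X^2 + 3 C^2 = 3^k\<close> with
  \<open>k = 3h\<close>, \<open>4h\<close>, \<open>5h\<close>. As \<open>h\<close> is odd, only
  \<open>4h\<close> is even, so only then can the real part \<open>X\<close> survive.\<close>

lemma S_values:
  obtains "S b = 0"
  | "S b = 3 ^ (2 * h) \<or> S b = - (3 ^ (2 * h))" "card (Rad b) = 3 ^ h"
proof -
  obtain X C :: int where XC: "Q b = Complex (of_int X) (of_int C * sqrt 3)"
    using Q_integral by blast
  have SX: "S b = of_int X" by (simp add: S_eq_Re_Q XC)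
  have "Q b * cnj (Q b) = of_int (X\<^sup>2 + 3 * C\<^sup>2)"
    by (simp add: XC complex_eq_iff power2_eq_square algebra_simps)
  then have "of_int (X\<^sup>2 + 3 * C\<^sup>2) = (of_int (3 ^ (3 * h) * int (card (Rad b))) :: complex)"
    by (simp add: norm_Q)
  then have eq: "X\<^sup>2 + 3 * C\<^sup>2 = 3 ^ (3 * h) * int (card (Rad b))"
    by (simp only: of_int_eq_iff)
  consider "card (Rad b) = 1" | "card (Rad b) = 3 ^ h" | "card (Rad b) = 3 ^ (2 * h)"
    using card_Rad by auto
  then show ?thesis
  proof cases
    case 1
    then have "X\<^sup>2 + 3 * C\<^sup>2 = 3 ^ (3 * h)" using eq by simp
    from sq_plus_three_sq_eq_power_three[OF this] have "X = 0" using odd_h by simp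
    then show ?thesis using SX that(1) by simp
  next
    case 2
    then have *: "X\<^sup>2 + 3 * C\<^sup>2 = 3 ^ (3 * h + h)" using eq by (simp only: power_add of_nat_power of_nat_numeral)
    from sq_plus_three_sq_eq_power_three[OF this] have "C = 0" using odd_h by simp
    moreover have "(3::int) ^ (3 * h + h) = (3 ^ (2 * h))\<^sup>2"
      by (simp flip: power_mult)
    ultimately have "X = 3 ^ (2 * h) \<or> X = - (3 ^ (2 * h))"
      using * by (simp add: power2_eq_iff)
    then have "S b = 3 ^ (2 * h) \<or> S b = - (3 ^ (2 * h))"
      using SX by auto
    then show ?thesis using 2 that(2) by blast
  next
    case 3
    then have "X\<^sup>2 + 3 * C\<^sup>2 = 3 ^ (3 * h + 2 * h)" using eq by (simp only: power_add of_nat_power of_nat_numeral)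
    from sq_plus_three_sq_eq_power_three[OF this] have "X = 0" using odd_h by simp
    then show ?thesis using SX that(1) by simp
  qed
qed

section \<open>The singularity condition\<close>

lemma S_nonzero_imp_singular:
  assumes "S b \<noteq> 0"
  shows "1 + b * \<sigma> b * \<sigma> (\<sigma> b) = b * b + \<sigma> b * \<sigma> b + \<sigma> (\<sigma> b) * \<sigma> (\<sigma> b)"
proof -
  have "card (Rad b) = 3 ^ h" using assms by (cases rule: S_values[of b]) auto
  then have "card (Rad b) \<noteq> 1" using h_pos by simp
  moreover have "card (Rad b) = 1" if "Rad b \<subseteq> {0}"
  proof -
    have "Rad b = {0}" using that by (auto simp: Rad_def)
    then show ?thesis by simp
  qed
  ultimately obtain y where "y \<in> Rad b" "y \<noteq> 0" by blast
  then show ?thesis by (rule Rad_nontrivial)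
qed

text \<open>At \<open>b = 1\<close> the singularity equation reads \<open>2 = 3\<close>, which fails
  in characteristic 3.\<close>

lemma S_1: "S 1 = 0"
proof (rule ccontr)
  assume "S 1 \<noteq> 0"
  from S_nonzero_imp_singular[OF this] have "(2::'a) = 3" by simp
  then show False by (simp add: three_eq_0 two_eq)
qed

lemma S_nonzero_imp_norm_square:
  fixes a :: 'a
  defines "N \<equiv> a * \<sigma> a * \<sigma> (\<sigma> a)" and "T \<equiv> a + \<sigma> a + \<sigma> (\<sigma> a)"
  assumes "S (1 + a) \<noteq> 0"
  shows "N = (T - 1) * (T - 1)"
proof -
  define a1 a2 where "a1 = \<sigma> a" and "a2 = \<sigma> (\<sigma> a)"
  have *: "1 + (1 + a) * (1 + a1) * (1 + a2) = (1 + a) * (1 + a) + (1 + a1) * (1 + a1) + (1 + a2) * (1 + a2)"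
    using S_nonzero_imp_singular[OF assms(3)] by (simp add: a1_def a2_def)
  \<comment> \<open>The norm condition and the singularity condition at \<open>1 + a\<close> differ
    by a multiple of 3.\<close>
  have "a * a1 * a2 - (a + a1 + a2 - 1) * (a + a1 + a2 - 1)
    = (1 + (1 + a) * (1 + a1) * (1 + a2) - ((1 + a) * (1 + a) + (1 + a1) * (1 + a1) + (1 + a2) * (1 + a2)))
      + 3 * (a + a1 + a2 - (a * a1 + a * a2 + a1 * a2))"
    by (simp add: algebra_simps)
  then have "a * a1 * a2 - (a + a1 + a2 - 1) * (a + a1 + a2 - 1) = 0"
    unfolding * by (simp add: three_eq_0)
  then show ?thesis by (simp add: N_def T_def a1_def a2_def)
qed

lemma S_plus_minus: "S (1 + a) = 0 \<or> S (1 - a) = 0"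
proof (rule ccontr)
  assume "\<not> ?thesis"
  then have nz: "S (1 + a) \<noteq> 0" "S (1 + - a) \<noteq> 0" by simp_all
  define N T where "N = a * \<sigma> a * \<sigma> (\<sigma> a)" and "T = a + \<sigma> a + \<sigma> (\<sigma> a)"
  have 1: "N = (T - 1) * (T - 1)"
    using S_nonzero_imp_norm_square[OF nz(1)] by (simp add: N_def T_def)
  have "- N = (- T - 1) * (- T - 1)"
    using S_nonzero_imp_norm_square[OF nz(2)] by (simp add: N_def T_def algebra_simps)
  then have "(T - 1) * (T - 1) + (- T - 1) * (- T - 1) = 0" unfolding 1[symmetric] by (metis add.right_inverse)
  then have "T - 1 = 0 \<and> - T - 1 = 0" by (rule sum_squares_eq_0)
  then have "T = 1" "- T = 1" by (metis eq_iff_diff_eq_0)+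
  then show False using neg_one_neq by metis
qed

section \<open>Moments and the value distribution\<close>

text \<open>Orthogonality in \<open>b\<close> leaves only the term \<open>x = 0\<close>.\<close>

lemma sum_S: "(\<Sum>b\<in>UNIV. S b) = 3 ^ (3 * h)"
proof -
  have "S b = (\<Sum>x\<in>UNIV. \<psi> (x ^ ell) * \<psi> (x * b))" for b
    by (simp add: S_def psi3_add mult.commute[of b])
  then have "(\<Sum>b\<in>UNIV. S b) = (\<Sum>b\<in>UNIV. \<Sum>x\<in>UNIV. \<psi> (x ^ ell) * \<psi> (x * b))"
    by simp
  also have "\<dots> = (\<Sum>x\<in>UNIV. \<psi> (x ^ ell) * (\<Sum>b\<in>UNIV. \<psi> (x * b)))"
    by (subst sum.swap) (simp add: sum_distrib_left)
  also have "\<dots> = (\<Sum>x\<in>(UNIV::'a set). if x = 0 then 3 ^ (3 * h) else 0)"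
    using odd_ell by (intro sum.cong) (auto simp: sum_psi3 power_0_left elim: oddE)
  finally show ?thesis by simp
qed

text \<open>Parseval: \<open>S\<close> is real, so the square is \<open>S b * cnj (S b)\<close>, and
  summing over \<open>b\<close> leaves the diagonal \<open>x = y\<close>.\<close>

lemma sum_S_sq: "(\<Sum>b\<in>UNIV. S b * S b) = 3 ^ (6 * h)"
proof -
  have "(\<Sum>b\<in>UNIV. S b * S b) = (\<Sum>b\<in>UNIV. S b * cnj (S b))" by simp
  also have "\<dots> = (\<Sum>b\<in>UNIV. \<Sum>x\<in>UNIV. \<Sum>y\<in>UNIV. \<psi> (x ^ ell - y ^ ell) * \<psi> ((x - y) * b))"
  proof (rule sum.cong[OF refl])
    fix b
    have "\<psi> (x ^ ell + b * x) * cnj (\<psi> (y ^ ell + b * y)) = \<psi> (x ^ ell - y ^ ell) * \<psi> ((x - y) * b)" for x y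
    proof -
      have "x ^ ell + b * x - (y ^ ell + b * y) = x ^ ell - y ^ ell + (x - y) * b"
        by (simp add: algebra_simps)
      then show ?thesis by (metis psi3_add psi3_diff)
    qed
    then show "S b * cnj (S b) = (\<Sum>x\<in>UNIV. \<Sum>y\<in>UNIV. \<psi> (x ^ ell - y ^ ell) * \<psi> ((x - y) * b))"
      unfolding S_def cnj_sum sum_product by simp
  qed
  also have "\<dots> = (\<Sum>x\<in>UNIV. \<Sum>y\<in>UNIV. \<psi> (x ^ ell - y ^ ell) * (\<Sum>b\<in>UNIV. \<psi> ((x - y) * b)))"
    by (subst sum.swap, rule sum.cong[OF refl], subst sum.swap) (simp add: sum_distrib_left)
  also have "\<dots> = (\<Sum>x\<in>(UNIV::'a set). \<Sum>y\<in>UNIV. if y = x then 3 ^ (3 * h) else 0)"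
    by (intro sum.cong) (auto simp: sum_psi3)
  also have "\<dots> = of_nat (card (UNIV :: 'a set)) * 3 ^ (3 * h)" by simp
  also have "\<dots> = 3 ^ (3 * h + 3 * h)" unfolding card_field power_add by simp
  also have "3 * h + 3 * h = 6 * h" by simp
  finally show ?thesis .
qed

text \<open>Dividing the moments by \<open>q^2\<close> and \<open>q^4\<close> gives
  \<open>p - n = q\<close> and \<open>p + n = q^2\<close> for the two multiplicities.\<close>

lemma card_S:
  "2 * card {b. S b = 3 ^ (2 * h)} = 3 ^ (2 * h) + 3 ^ h" (is "2 * ?p = _")
  "2 * card {b. S b = - (3 ^ (2 * h))} = 3 ^ (2 * h) - 3 ^ h" (is "2 * ?n = _")
proof -
  let ?q = "3 ^ h :: int" and ?P = "{b. S b = 3 ^ (2 * h)}" and ?N = "{b. S b = - (3 ^ (2 * h))}"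
  have ne: "(3::complex) ^ (2 * h) \<noteq> - (3 ^ (2 * h))"
    by (simp add: complex_eq_iff)
  have S_eq: "S b = (if b \<in> ?P then 3 ^ (2 * h) else 0) - (if b \<in> ?N then 3 ^ (2 * h) else 0)" for b
    using ne by (cases rule: S_values[of b]) auto
  have SS_eq: "S b * S b = (if b \<in> ?P then 3 ^ (4 * h) else 0) + (if b \<in> ?N then 3 ^ (4 * h) else 0)" for b
    using ne by (cases rule: S_values[of b]) (auto simp flip: power_add)
  have "(\<Sum>b\<in>UNIV. S b) = of_nat ?p * 3 ^ (2 * h) - of_nat ?n * 3 ^ (2 * h)"
    by (subst sum.cong[OF refl S_eq]) (simp add: sum_subtractf sum.If_cases)
  then have "(of_int (?q ^ 3) :: complex) = of_int ((int ?p - int ?n) * ?q ^ 2)"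
    unfolding sum_S by (simp add: algebra_simps flip: power_mult)
  then have "?q * ?q ^ 2 = (int ?p - int ?n) * ?q ^ 2"
    unfolding of_int_eq_iff by (simp add: power3_eq_cube power2_eq_square)
  then have 1: "int ?p - int ?n = ?q" by simp
  have "(\<Sum>b\<in>UNIV. S b * S b) = of_nat ?p * 3 ^ (4 * h) + of_nat ?n * 3 ^ (4 * h)"
    by (subst sum.cong[OF refl SS_eq]) (simp add: sum.distrib sum.If_cases)
  then have "(of_int (?q ^ 6) :: complex) = of_int ((int ?p + int ?n) * ?q ^ 4)"
    unfolding sum_S_sq by (simp add: algebra_simps flip: power_mult)
  then have "?q ^ 2 * ?q ^ 4 = (int ?p + int ?n) * ?q ^ 4"
    unfolding of_int_eq_iff by (simp flip: power_add)
  then have 2: "int ?p + int ?n = 3 ^ (2 * h)" by (simp flip: power_mult add: mult.commute)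
  from 1 2 have "int (2 * ?p) = int (3 ^ (2 * h) + 3 ^ h)" by simp
  then show "2 * ?p = 3 ^ (2 * h) + 3 ^ h" by (simp only: of_nat_eq_iff)
  have "(3::nat) ^ h \<le> 3 ^ (2 * h)" by (rule power_increasing) auto
  with 1 2 have "int (2 * ?n) = int (3 ^ (2 * h) - 3 ^ h)" by (simp add: of_nat_diff)
  then show "2 * ?n = 3 ^ (2 * h) - 3 ^ h" by (simp only: of_nat_eq_iff)
qed

section \<open>Counting trace zeros by characters\<close>

abbreviation zeros :: "'a set" where
  "zeros \<equiv> {x. tr3 (3 * h) (x + x ^ ell) = 0}"

lemma card_eq_sum_indicator: "of_nat (card {x::'a. P x}) = (\<Sum>x\<in>UNIV. if P x then 1 else (0::complex))"
  by (simp add: sum.If_cases)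

lemma sum_cnj_S:
  "(\<Sum>x\<in>UNIV. \<psi> (x ^ ell + b * x)) = S b" "(\<Sum>x\<in>UNIV. cnj (\<psi> (x ^ ell + b * x))) = S b"
  using cnj_S[of b] by (simp_all add: S_def del: cnj_S)

lemma card_zeros: "3 * card zeros = 3 ^ (3 * h)"
proof -
  have "of_nat (card zeros) = (\<Sum>x\<in>UNIV. (1 + \<psi> (x ^ ell + 1 * x) + cnj (\<psi> (x ^ ell + 1 * x))) / 3)"
    unfolding card_eq_sum_indicator tr3_eq_0_indicator by (simp add: add.commute)
  also have "\<dots> = (of_nat (card (UNIV::'a set)) + S 1 + S 1) / 3"
    unfolding sum_divide_distrib[symmetric] sum.distrib sum_cnj_S by simp
  finally have "(of_nat (3 * card zeros) :: complex) = of_nat (3 ^ (3 * h))"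
    by (simp add: S_1 card_field mult.commute)
  then show ?thesis by (simp only: of_nat_eq_iff)
qed

text \<open>The product of two indicators has nine character terms: the constant one, two summing to
  \<open>S 1 = 0\<close>, two vanishing by orthogonality, and two each for \<open>S (1 + a)\<close>
  and \<open>S (1 - a)\<close>.\<close>

lemma card_zeros_hyperplane:
  assumes "a \<noteq> 0"
  shows "9 * (of_nat (card {x \<in> zeros. tr3 (3 * h) (a * x) = 0}) :: complex)
    = 3 ^ (3 * h) + 2 * (S (1 + a) + S (1 - a))"
proof -
  let ?u = "\<lambda>x. \<psi> (x ^ ell + 1 * x)" and ?v = "\<lambda>x. \<psi> (a * x)"
  let ?p = "\<lambda>x. \<psi> (x ^ ell + (1 + a) * x)" and ?m = "\<lambda>x. \<psi> (x ^ ell + (1 - a) * x)"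
  have p: "?u x * ?v x = ?p x" for x
    unfolding psi3_add[symmetric] by (simp add: distrib_right add.assoc)
  have m: "?u x * cnj (?v x) = ?m x" for x
    unfolding psi3_diff[symmetric] by (simp add: left_diff_distrib add_diff_eq)
  have "9 * (if x \<in> zeros \<and> tr3 (3 * h) (a * x) = 0 then 1 else 0)
    = 1 + ?v x + cnj (?v x) + ?u x + cnj (?u x) + ?p x + cnj (?p x) + ?m x + cnj (?m x)" for x
  proof -
    have "9 * (if x \<in> zeros \<and> tr3 (3 * h) (a * x) = 0 then 1 else 0)
      = 9 * ((if tr3 (3 * h) (x ^ ell + 1 * x) = 0 then 1 else 0) * (if tr3 (3 * h) (a * x) = 0 then 1 else 0 :: complex))"
      by (simp add: add.commute)
    also have "\<dots> = (1 + ?u x + cnj (?u x)) * (1 + ?v x + cnj (?v x))"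
      unfolding tr3_eq_0_indicator by simp
    also have "\<dots> = 1 + ?v x + cnj (?v x) + ?u x + cnj (?u x) + ?u x * ?v x + cnj (?u x * ?v x)
      + ?u x * cnj (?v x) + cnj (?u x * cnj (?v x))"
      by (simp add: algebra_simps)
    finally show ?thesis unfolding p m .
  qed
  moreover have "(\<Sum>x\<in>UNIV. ?v x) = 0" using assms by (simp add: sum_psi3)
  moreover from this have "(\<Sum>x\<in>UNIV. cnj (?v x)) = 0" by (metis cnj_sum complex_cnj_zero)
  ultimately have "9 * (\<Sum>x\<in>UNIV. if x \<in> zeros \<and> tr3 (3 * h) (a * x) = 0 then 1 else (0::complex))
    = of_nat (card (UNIV::'a set)) + (S (1 + a) + S (1 + a) + S (1 - a) + S (1 - a))"
    unfolding sum_distrib_left by (simp only: sum.distrib sum_cnj_S S_1) simp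
  then show ?thesis unfolding card_eq_sum_indicator by (simp add: card_field)
qed

lemma card_zeros_off_hyperplane:
  assumes "a \<noteq> 0"
  shows "9 * (of_nat (card {x \<in> zeros. tr3 (3 * h) (a * x) \<noteq> 0}) :: complex)
    = 2 * (3 ^ (3 * h) - (S (1 + a) + S (1 - a)))"
proof -
  have "zeros = {x \<in> zeros. tr3 (3 * h) (a * x) = 0} \<union> {x \<in> zeros. tr3 (3 * h) (a * x) \<noteq> 0}"
    by blast
  then have "card zeros = card {x \<in> zeros. tr3 (3 * h) (a * x) = 0} + card {x \<in> zeros. tr3 (3 * h) (a * x) \<noteq> 0}"
    by (metis (no_types, lifting) card_Un_disjoint disjoint_iff finite mem_Collect_eq)
  then have "9 * (of_nat (card {x \<in> zeros. tr3 (3 * h) (a * x) \<noteq> 0}) :: complex)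
      = 3 * of_nat (3 * card zeros) - 9 * of_nat (card {x \<in> zeros. tr3 (3 * h) (a * x) = 0})"
    by simp
  then show ?thesis unfolding card_zeros card_zeros_hyperplane[OF assms] by simp
qed

text \<open>At most one summand is nonzero, so the solutions split into a disjoint translate and
  reflection of the level set of \<open>S\<close>.\<close>

lemma card_S_plus_minus:
  assumes "c \<noteq> 0"
  shows "card {a. S (1 + a) + S (1 - a) = c} = 2 * card {b. S b = c}"
proof -
  let ?P = "{b. S b = c}" and ?f = "\<lambda>b. b - (1::'a)" and ?g = "\<lambda>b. (1::'a) - b"
  have "{a. S (1 + a) + S (1 - a) = c} = ?f ` ?P \<union> ?g ` ?P"
  proof (rule set_eqI)
    fix a
    have "a \<in> ?f ` ?P \<longleftrightarrow> S (1 + a) = c"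
      by (metis (mono_tags, lifting) add.commute add_diff_cancel_left' diff_add_cancel image_iff mem_Collect_eq)
    moreover have "a \<in> ?g ` ?P \<longleftrightarrow> S (1 - a) = c"
      by (auto simp: image_iff)
    moreover have "S (1 + a) + S (1 - a) = c \<longleftrightarrow> S (1 + a) = c \<or> S (1 - a) = c"
      using S_plus_minus[of a] assms by (elim disjE) simp_all
    ultimately show "a \<in> {a. S (1 + a) + S (1 - a) = c} \<longleftrightarrow> a \<in> ?f ` ?P \<union> ?g ` ?P"
      by blast
  qed
  moreover have "?f ` ?P \<inter> ?g ` ?P = {}"
  proof (rule ccontr)
    assume "?f ` ?P \<inter> ?g ` ?P \<noteq> {}"
    then obtain a where "a \<in> ?f ` ?P" "a \<in> ?g ` ?P" by blast
    then have "S (1 + a) = c" "S (1 - a) = c" by auto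
    then show False using S_plus_minus[of a] assms by simp
  qed
  moreover have "card (?f ` ?P) = card ?P" "card (?g ` ?P) = card ?P"
    by (rule card_image, simp add: inj_on_def)+
  ultimately show ?thesis by (simp add: card_Un_disjoint)
qed

end

section \<open>Half systems: one representative of each pair \<open>x\<close>,
  \<open>-x\<close>\<close>

text \<open>With \<open>n\<close> half the group order, \<open>\<alpha> ^ n = -1\<close>, so
  negation exchanges the first \<open>n\<close> powers with the last \<open>n\<close>.\<close>

lemma (in ternary_field) generator_half_system:
  fixes \<alpha> :: 'a
  assumes gen: "\<forall>x::'a. x \<noteq> 0 \<longrightarrow> (\<exists>k::nat. x = \<alpha> ^ k)"
  defines "H \<equiv> {\<alpha> ^ t | t. t < (3 ^ m - 1) div 2}"
  shows "0 \<notin> H" "x \<noteq> 0 \<Longrightarrow> x \<in> H \<longleftrightarrow> - x \<notin> H"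
proof -
  define n :: nat where "n = (3 ^ m - 1) div 2"
  have "even ((3::nat) ^ m - 1)" by simp
  then have n2: "(3::nat) ^ m - 1 = 2 * n" unfolding n_def by simp
  have n3: "(3::nat) ^ m = Suc (2 * n)" using n2 by (metis Suc_pred' zero_less_numeral zero_less_power)
  have "(3::nat) ^ 1 \<le> 3 ^ m" using m_pos by (intro power_increasing) auto
  then have n_pos: "n > 0" using n3 by simp
  \<comment> \<open>Powers of 0 are only 0 and 1, so 1 would be the sole nonzero element,
    contradicting \<open>-1 \<noteq> 1\<close>.\<close>
  have \<alpha>0: "\<alpha> \<noteq> 0"
  proof
    assume "\<alpha> = 0"
    then have "x = 1" if "x \<noteq> 0" for x :: 'a
      using gen[rule_format, OF that] by (metis power_0_left that)
    then have "(-1::'a) = 1" by simp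
    then show False using neg_one_neq by simp
  qed
  have "\<alpha> * \<alpha> ^ (2 * n) = \<alpha>" using power_card[of \<alpha>] unfolding n3 by simp
  then have \<alpha>n: "\<alpha> ^ (2 * n) = 1" using \<alpha>0 by simp
  have range: "(\<lambda>k. \<alpha> ^ k) ` {..<2 * n} = UNIV - {0}"
  proof (rule antisym)
    show "UNIV - {0} \<subseteq> (\<lambda>k. \<alpha> ^ k) ` {..<2 * n}"
    proof
      fix x :: 'a assume "x \<in> UNIV - {0}"
      then obtain k where k: "x = \<alpha> ^ k" using gen by blast
      also have "\<dots> = \<alpha> ^ (2 * n * (k div (2 * n)) + k mod (2 * n))" by simp
      also have "\<dots> = \<alpha> ^ (k mod (2 * n))"
        unfolding power_add power_mult[of _ "2 * n"] \<alpha>n by simp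
      finally show "x \<in> (\<lambda>k. \<alpha> ^ k) ` {..<2 * n}" using n_pos by auto
    qed
  qed (use \<alpha>0 in auto)
  \<comment> \<open>The \<open>2 * n\<close> exponents reach all \<open>2 * n\<close> nonzero
    elements, hence without repetition.\<close>
  have "card (UNIV - {0::'a}) = 2 * n"
    by (simp add: card_Diff_singleton card_field n3)
  then have inj: "inj_on (\<lambda>k. \<alpha> ^ k) {..<2 * n}"
    using range by (intro eq_card_imp_inj_on) auto
  have "\<alpha> ^ n * \<alpha> ^ n = 1 * 1" using \<alpha>n by (simp flip: power_add add: mult_2)
  then have "\<alpha> ^ n = 1 \<or> \<alpha> ^ n = -1" by (simp only: square_eq_iff)
  moreover have "\<alpha> ^ n \<noteq> \<alpha> ^ 0" using inj_onD[OF inj, of n 0] n_pos by auto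
  ultimately have neg: "\<alpha> ^ n = -1" by simp
  have H: "\<alpha> ^ k \<in> H \<longleftrightarrow> k < n" if "k < 2 * n" for k
    using inj_onD[OF inj, of k] that unfolding H_def n_def[symmetric] by fastforce
  show "0 \<notin> H" using \<alpha>0 by (auto simp: H_def)
  assume "x \<noteq> 0"
  then obtain k where k: "x = \<alpha> ^ k" "k < 2 * n" using range by blast
  show "x \<in> H \<longleftrightarrow> - x \<notin> H"
  proof (cases "k < n")
    case True
    have "- x = \<alpha> ^ (k + n)" by (simp add: k power_add neg)
    then show ?thesis using H[OF k(2)] H[of "k + n"] True k(1) by simp
  next
    case False
    then have "\<alpha> ^ k = \<alpha> ^ (k - n) * \<alpha> ^ n" by (simp flip: power_add)
    then have "- x = \<alpha> ^ (k - n)" by (simp add: k neg)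
    then show ?thesis using H[OF k(2)] H[of "k - n"] False k by simp
  qed
qed

lemma card_half_system:
  fixes A H :: "'a::{ab_group_add,finite} set"
  assumes "\<And>x. x \<in> A \<Longrightarrow> - x \<in> A" "\<And>x. x \<in> A \<Longrightarrow> x \<in> H \<longleftrightarrow> - x \<notin> H"
  shows "card A = 2 * card (A \<inter> H)"
proof -
  have "A - H = uminus ` (A \<inter> H)"
  proof (rule set_eqI)
    fix x
    show "x \<in> A - H \<longleftrightarrow> x \<in> uminus ` (A \<inter> H)"
      using assms[of x] assms[of "- x"] by (auto simp: image_iff intro: bexI[of _ "- x"])
  qed
  then have "card (A - H) = card (A \<inter> H)" by (simp add: card_image)
  moreover have "card A = card (A - H) + card (A \<inter> H)"
    by (metis Int_Diff_Un Int_Diff_disjoint add.commute card_Un_disjoint finite)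
  ultimately show ?thesis by simp
qed

section \<open>The code: length, dimension and weight distribution\<close>

theorem mainTheorem11:
  fixes h m l :: nat and \<alpha> :: "'a::{field,finite}" and D :: "'a set"
  assumes "odd h" and "h > 0"
    and "m = 3 * h"
    and "l = 3 ^ (2 * h) - 3 ^ h + 1"
    and "card (UNIV :: 'a set) = 3 ^ m"
    and "\<forall>x::'a. x \<noteq> 0 \<longrightarrow> (\<exists>k::nat. x = \<alpha> ^ k)"
    and "D = {\<alpha> ^ t | t. t < (3 ^ m - 1) div 2 \<and> tr3 m (\<alpha> ^ t + \<alpha> ^ (t * l)) = 0}"
  shows "card D = (3 ^ (3 * h - 1) - 1) div 2
    \<and> card (codeD m D) = 3 ^ (3 * h)
    \<and> min_dist D (codeD m D) = 3 ^ (3 * h - 2) - 3 ^ (2 * h - 2)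
    \<and> (\<forall>c \<in> codeD m D. c \<noteq> (\<lambda>_. 0) \<longrightarrow>
          hwt D c \<in> {3 ^ (3 * h - 2) - 3 ^ (2 * h - 2), 3 ^ (3 * h - 2), 3 ^ (3 * h - 2) + 3 ^ (2 * h - 2)})
    \<and> card {c \<in> codeD m D. c \<noteq> (\<lambda>_. 0) \<and> hwt D c = 3 ^ (3 * h - 2) - 3 ^ (2 * h - 2)}
        = 3 ^ (2 * h) + 3 ^ h
    \<and> card {c \<in> codeD m D. c \<noteq> (\<lambda>_. 0) \<and> hwt D c = 3 ^ (3 * h - 2)}
        = 3 ^ (3 * h) - 2 * 3 ^ (2 * h) - 1
    \<and> card {c \<in> codeD m D. c \<noteq> (\<lambda>_. 0) \<and> hwt D c = 3 ^ (3 * h - 2) + 3 ^ (2 * h - 2)}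
        = 3 ^ (2 * h) - 3 ^ h"
proof -
  interpret cubic_field h "TYPE('a)"
    by unfold_locales (use assms in auto)
  define H where "H = {\<alpha> ^ t | t. t < (3 ^ (3 * h) - 1) div 2}"
  note half = generator_half_system[OF assms(6), folded H_def]
  have l: "l = ell" by (simp add: assms(4) ell_def)
  \<comment> \<open>Removing 0 leaves a set closed under negation, in which \<open>H\<close> picks
    one element of each pair.\<close>
  have D: "D = (zeros - {0}) \<inter> H"
  proof -
    have "D = zeros \<inter> H" unfolding assms(7) H_def l assms(3) by (auto simp: power_mult)
    then show ?thesis using half(1) by blast
  qed
  have zeros_minus: "- x \<in> zeros" if "x \<in> zeros" for x
  proof -
    have "- x + (- x) ^ ell = - (x + x ^ ell)" using odd_ell by (simp add: power_minus_odd)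
    then show ?thesis using that tr3_minus[of "x + x ^ ell"] by simp
  qed

  have "0 \<in> zeros" using odd_ell by (auto simp: tr3_0 power_0_left)
  have "card (zeros - {0}) = 2 * card D"
    unfolding D
  proof (rule card_half_system)
    fix x assume x: "x \<in> zeros - {0}"
    then show "- x \<in> zeros - {0}" using zeros_minus[of x] by simp
    show "x \<in> H \<longleftrightarrow> - x \<notin> H" using x by (intro half(2)) blast
  qed
  then have "2 * card D = card zeros - 1" using \<open>0 \<in> zeros\<close> by (simp add: card_Diff_singleton)
  moreover have "3 * card zeros = 3 * 3 ^ (3 * h - 1)"
    using card_zeros \<open>h > 0\<close> by (simp flip: power_Suc)
  ultimately have card_D: "card D = (3 ^ (3 * h - 1) - 1) div 2" by simp

  define cw where "cw a = (\<lambda>d. if d \<in> D then tr3 m (a * d) else 0)" for a :: 'a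
  have code: "codeD m D = range cw" by (simp add: codeD_def cw_def[abs_def])
  have cw_0: "cw 0 = (\<lambda>_. 0)" using tr3_0 by (auto simp: cw_def assms(3))
  have hwt_cw: "hwt D (cw a) = card {d \<in> D. tr3 (3 * h) (a * d) \<noteq> 0}" for a
    unfolding hwt_def cw_def assms(3) by (rule arg_cong[where f = card]) auto
  define v where "v a = S (1 + a) + S (1 - a)" for a
  \<comment> \<open>Passing to the half system cancels the factor 2 in
    \<open>card_zeros_off_hyperplane\<close>.\<close>
  have weight: "9 * of_nat (hwt D (cw a)) = 3 ^ (3 * h) - v a" if "a \<noteq> 0" for a
  proof -
    let ?A = "{x \<in> zeros. tr3 (3 * h) (a * x) \<noteq> 0}"
    have A: "x \<noteq> 0" if "x \<in> ?A" for x using that tr3_0 by auto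
    have "card ?A = 2 * card (?A \<inter> H)"
    proof (rule card_half_system)
      fix x assume x: "x \<in> ?A"
      then show "- x \<in> ?A" using zeros_minus[of x] tr3_minus[of "a * x"] by simp
      show "x \<in> H \<longleftrightarrow> - x \<notin> H" by (rule half(2)[OF A[OF x]])
    qed
    moreover have "?A \<inter> H = {d \<in> D. tr3 (3 * h) (a * d) \<noteq> 0}"
      unfolding D using A by blast
    ultimately have "2 * (9 * of_nat (hwt D (cw a))) = 2 * (3 ^ (3 * h) - v a)"
      using card_zeros_off_hyperplane[OF that] by (simp add: hwt_cw v_def)
    then show ?thesis unfolding mult_cancel_left by simp
  qed

  \<comment> \<open>These are \<open>q^3 / 9\<close> and \<open>q^2 / 9\<close>; the exponents do
    not truncate because \<open>h > 0\<close>.\<close>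
  define w e :: nat where "w = 3 ^ (3 * h - 2)" and "e = 3 ^ (2 * h - 2)"
  have w9: "9 * w = 3 ^ (3 * h)"
  proof -
    have "2 + (3 * h - 2) = 3 * h" using \<open>h > 0\<close> by linarith
    then have "(3::nat) ^ (3 * h) = 3 ^ 2 * 3 ^ (3 * h - 2)" by (metis power_add)
    then show ?thesis by (simp add: w_def)
  qed
  have e9: "9 * e = 3 ^ (2 * h)"
  proof -
    have "2 + (2 * h - 2) = 2 * h" using \<open>h > 0\<close> by linarith
    then have "(3::nat) ^ (2 * h) = 3 ^ 2 * 3 ^ (2 * h - 2)" by (metis power_add)
    then show ?thesis by (simp add: e_def)
  qed
  have ew: "0 < e" "e < w"
    using \<open>h > 0\<close> unfolding w_def e_def by (auto intro: power_strict_increasing)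
  have ce: "(3::complex) ^ (2 * h) = of_nat (9 * e)" "(3::complex) ^ (3 * h) = of_nat (9 * w)"
    unfolding e9 w9 by simp_all
  define c where "c = (3::complex) ^ (2 * h)"
  have c0: "c \<noteq> 0" "- c \<noteq> 0" "c \<noteq> - c" "- c \<noteq> c"
    by (auto simp: c_def complex_eq_iff)
  have v_cases: "v a = c \<or> v a = - c \<or> v a = 0" for a
    using S_plus_minus[of a] by (cases rule: S_values[of "1 + a"]; cases rule: S_values[of "1 - a"])
      (auto simp: v_def c_def)
  have wt: "v a = c \<Longrightarrow> hwt D (cw a) = w - e" "v a = - c \<Longrightarrow> hwt D (cw a) = w + e"
    "v a = 0 \<Longrightarrow> hwt D (cw a) = w" if "a \<noteq> 0" for a
  proof -
    note wa = weight[OF that, unfolded ce]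
    show "hwt D (cw a) = w - e" if "v a = c"
    proof -
      have "(of_nat (9 * hwt D (cw a) + 9 * e) :: complex) = of_nat (9 * w)"
        using wa unfolding that c_def ce by simp
      then have "9 * hwt D (cw a) + 9 * e = 9 * w" unfolding of_nat_eq_iff .
      then show ?thesis by simp
    qed
    show "hwt D (cw a) = w + e" if "v a = - c"
    proof -
      have "(of_nat (9 * hwt D (cw a)) :: complex) = of_nat (9 * w + 9 * e)"
        using wa unfolding that c_def ce by simp
      then have "9 * hwt D (cw a) = 9 * w + 9 * e" unfolding of_nat_eq_iff .
      then show ?thesis by simp
    qed
    show "hwt D (cw a) = w" if "v a = 0"
    proof -
      have "(of_nat (9 * hwt D (cw a)) :: complex) = of_nat (9 * w)"
        using wa unfolding that by simp
      then have "9 * hwt D (cw a) = 9 * w" unfolding of_nat_eq_iff .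
      then show ?thesis by simp
    qed
  qed
  have v_0: "v 0 = 0" by (simp add: v_def S_1)
  have wt_iff: "hwt D (cw a) = w - e \<longleftrightarrow> v a = c" "hwt D (cw a) = w + e \<longleftrightarrow> v a = - c"
    "hwt D (cw a) = w \<longleftrightarrow> v a = 0" if "a \<noteq> 0" for a
    using wt[OF that] v_cases[of a] ew c0 by auto
  \<comment> \<open>Since \<open>e < w\<close>, all three candidate weights are positive; the linear
    map \<open>cw\<close> thus has trivial kernel, which gives the dimension.\<close>
  have cw_nz: "cw a \<noteq> (\<lambda>_. 0) \<longleftrightarrow> a \<noteq> 0" for a
  proof
    assume "a \<noteq> 0"
    then have "hwt D (cw a) > 0" using wt[of a] v_cases[of a] ew by auto
    then show "cw a \<noteq> (\<lambda>_. 0)" by (auto simp: hwt_def)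
  qed (use cw_0 in auto)
  have inj: "inj cw"
  proof (rule injI)
    fix a b assume eq: "cw a = cw b"
    have "cw (a - b) d = cw a d - cw b d" for d
      using tr3_add[of "(a - b) * d" "b * d"] by (simp add: cw_def assms(3) algebra_simps)
    then have "cw (a - b) = (\<lambda>_. 0)" using eq by auto
    then show "a = b" using cw_nz[of "a - b"] by simp
  qed
  have card_code: "card (codeD m D) = 3 ^ (3 * h)"
    unfolding code card_image[OF inj] using card_field .
  have count: "card {c \<in> codeD m D. c \<noteq> (\<lambda>_. 0) \<and> hwt D c = k} = card {a. a \<noteq> 0 \<and> hwt D (cw a) = k}" for k
  proof -
    have "{c \<in> codeD m D. c \<noteq> (\<lambda>_. 0) \<and> hwt D c = k} = cw ` {a. a \<noteq> 0 \<and> hwt D (cw a) = k}"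
      unfolding code using cw_nz by auto
    then show ?thesis using inj by (simp add: card_image inj_on_subset)
  qed
  have "{a. a \<noteq> 0 \<and> hwt D (cw a) = w - e} = {a. v a = c}"
    by (rule Collect_cong) (metis wt_iff(1) v_0 c0(1))
  moreover have cP: "card {a. v a = c} = 3 ^ (2 * h) + 3 ^ h"
    unfolding v_def card_S_plus_minus[OF c0(1)] unfolding c_def by (rule card_S)
  ultimately have count_low: "card {c \<in> codeD m D. c \<noteq> (\<lambda>_. 0) \<and> hwt D c = w - e} = 3 ^ (2 * h) + 3 ^ h"
    unfolding count by simp
  have "{a. a \<noteq> 0 \<and> hwt D (cw a) = w + e} = {a. v a = - c}"
    by (rule Collect_cong) (metis wt_iff(2) v_0 c0(2))
  moreover have cN: "card {a. v a = - c} = 3 ^ (2 * h) - 3 ^ h"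
    unfolding v_def card_S_plus_minus[OF c0(2)] unfolding c_def by (rule card_S)
  ultimately have count_high: "card {c \<in> codeD m D. c \<noteq> (\<lambda>_. 0) \<and> hwt D c = w + e} = 3 ^ (2 * h) - 3 ^ h"
    unfolding count by simp
  \<comment> \<open>The middle weight is counted by complement. The final \<open>- 1\<close> removes
    \<open>a = 0\<close>, which has \<open>v 0 = 0\<close> but yields the zero codeword.\<close>
  have "a \<noteq> 0 \<and> hwt D (cw a) = w \<longleftrightarrow> v a \<noteq> c \<and> v a \<noteq> - c \<and> a \<noteq> 0" for a
    by (metis wt_iff(3) v_cases c0(1,2))
  then have "{a. a \<noteq> 0 \<and> hwt D (cw a) = w} = UNIV - ({a. v a = c} \<union> {a. v a = - c}) - {0}"
    by blast
  moreover have "card ({a. v a = c} \<union> {a. v a = - c}) = 2 * 3 ^ (2 * h)"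
  proof -
    have "(3::nat) ^ h \<le> 3 ^ (2 * h)" by (rule power_increasing) auto
    then show ?thesis using c0 by (subst card_Un_disjoint) (auto simp: cP cN)
  qed
  moreover have "0 \<in> UNIV - ({a. v a = c} \<union> {a. v a = - c})" using v_0 c0 by auto
  ultimately have count_mid: "card {c \<in> codeD m D. c \<noteq> (\<lambda>_. 0) \<and> hwt D c = w} = 3 ^ (3 * h) - 2 * 3 ^ (2 * h) - 1"
    unfolding count by (simp add: card_Diff_singleton card_Diff_subset card_field)
  have weights: "hwt D c \<in> {w - e, w, w + e}" if "c \<in> codeD m D" "c \<noteq> (\<lambda>_. 0)" for c
    using that wt v_cases cw_nz unfolding code by blast
  \<comment> \<open>The positive multiplicity shows that the lowest candidate weight is attained, so
    it is the minimum.\<close>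
  have "{c \<in> codeD m D. c \<noteq> (\<lambda>_. 0) \<and> hwt D c = w - e} \<noteq> {}"
    using count_low by (metis add_is_0 card.empty power_not_zero zero_neq_numeral)
  then have ex: "w - e \<in> {hwt D c | c. c \<in> codeD m D \<and> c \<noteq> (\<lambda>_. 0)}" by force
  have sub: "{hwt D c | c. c \<in> codeD m D \<and> c \<noteq> (\<lambda>_. 0)} \<subseteq> {w - e, w, w + e}"
    using weights by blast
  have "min_dist D (codeD m D) = w - e"
    unfolding min_dist_def
  proof (rule Min_eqI)
    show "finite {hwt D c | c. c \<in> codeD m D \<and> c \<noteq> (\<lambda>_. 0)}"
      using finite_subset[OF sub] by simp
  qed (use ex sub in auto)
  then show ?thesis
    using card_D card_code weights count_low count_mid count_high unfolding w_def e_def by blast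
qed

end
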